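(* Let $\Sigma$ be a compact Riemann surface of genus $g\ge 2$ with a fixed square root $K^{1/2}$ of its canonical bundle $K$, let $V$ be a rank $2$ holomorphic vector bundle on $\Sigma$ with a holomorphic symplectic form, let $\psi$ be a holomorphic section of $S^3V\otimes K^{1/2}$, and let $\Phi=\mu(\psi)\in H^0(\Sigma,\mathrm{End}_0V\otimes K)$. Suppose that the spectral curve $S$ of $\Phi$ is smooth, with projection $\pi:S\to\Sigma$, and let $U$ be the line bundle on $S$ in the Prym variety of $S\to\Sigma$ associated to $(V,\Phi)$. Then $U^3$ is trivial.
   Context: Moment map: the symplectic form on $\mathbf{C}^2$ induces an $SL(2,\mathbf{C})$-invariant symplectic form on the space $S^3\mathbf{C}^2$ of binary cubics, and the moment map is (up to a fixed nonzero scalar) the quadratic map $\mu:S^3\mathbf{C}^2\to S^2\mathbf{C}^2\cong\mathfrak{sl}(2,\mathbf{C})$, $\mu(p)$ being the image of $p\otimes p$ under the invariant homomorphism $S^3\mathbf{C}^2\otimes S^3\mathbf{C}^2\to S^2\mathbf{C}^2$ given by contracting twice with the skew form on $\mathbf{C}^2$. Applied fibrewise to $\psi\in H^0(\Sigma,S^3V\otimes K^{1/2})$ it gives $\mu(\psi)\in H^0(\Sigma,S^2V\otimes K)=H^0(\Sigma,\mathrm{End}_0V\otimes K)$, where $\mathrm{End}_0$ denotes trace-zero endomorphisms. Spectral data: for a trace-zero $\Phi$ write its characteristic equation as $\det(x-\Phi)=x^2-q=0$ with $q=-\det\Phi\in H^0(\Sigma,K^2)$, where $x$ is the tautological section of the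 pull-back of $K$ to the total space of $K$. This equation defines the spectral curve $S$ in the total space of $K$, a double cover $\pi:S\to\Sigma$ with involution $\sigma:x\mapsto -x$; $S$ is smooth when $q$ has simple zeros. Let $L^*\subset\pi^*V$ be the line subbundle given by the eigenspace of $\pi^*\Phi$ with eigenvalue $x$, so that there is an exact sequence $0\to L^*\to\pi^*V\to L\to 0$. One has $L\otimes\sigma^*L\cong\pi^*K$, and $U$ is defined by $L\cong U\otimes\pi^*K^{1/2}$; it satisfies $\sigma^*U\cong U^*$ and hence defines a point of the Prym variety of $S\to\Sigma$. *)

theory Defs
  imports "HOL-Homology.Homology" "HOL-Complex_Analysis.Complex_Analysis"
begin

section \<open>Riemann surfaces\<close>

text \<open>A chart is a pair of its domain and its coordinate function; the values of the coordinate
  function outside the domain are irrelevant.\<close>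

type_synonym 'a chart = "'a set \<times> ('a \<Rightarrow> complex)"

record 'a surface =
  surf_top :: "'a topology"
  surf_atlas :: "'a chart set"

abbreviation points :: "'a surface \<Rightarrow> 'a set" where
  "points X \<equiv> topspace (surf_top X)"

abbreviation chart_inv :: "'a chart \<Rightarrow> complex \<Rightarrow> 'a" where
  "chart_inv c \<equiv> inv_into (fst c) (snd c)"

definition topological_chart :: "'a topology \<Rightarrow> 'a chart \<Rightarrow> bool" where
  "topological_chart T c \<longleftrightarrow>
     openin T (fst c) \<and> open (snd c ` fst c) \<and>
     homeomorphic_map (subtopology T (fst c)) (top_of_set (snd c ` fst c)) (snd c)"

definition riemann_surface :: "'a surface \<Rightarrow> bool" where
  "riemann_surface X \<longleftrightarrow>
     Hausdorff_space (surf_top X) \<and> connected_space (surf_top X) \<and> points X \<noteq> {} \<and>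
     (\<Union>c\<in>surf_atlas X. fst c) = points X \<and>
     (\<forall>c\<in>surf_atlas X. topological_chart (surf_top X) c) \<and>
     (\<forall>c\<in>surf_atlas X. \<forall>d\<in>surf_atlas X.
        (snd d \<circ> chart_inv c) holomorphic_on snd c ` (fst c \<inter> fst d))"

text \<open>Second countability is not required separately: it is automatic for compact surfaces.\<close>

definition compact_riemann_surface :: "'a surface \<Rightarrow> bool" where
  "compact_riemann_surface X \<longleftrightarrow> riemann_surface X \<and> compact_space (surf_top X)"

text \<open>The genus is read off from the first integral homology group.\<close>

definition has_genus :: "'a surface \<Rightarrow> nat \<Rightarrow> bool" where
  "has_genus X g \<longleftrightarrow> homology_group 1 (surf_top X) \<cong> free_Abelian_group {..<2 * g}"

text \<open>Holomorphy of a function on a subset \<open>W\<close>, which is open in all uses below.\<close>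

definition holo_on :: "'a surface \<Rightarrow> 'a set \<Rightarrow> ('a \<Rightarrow> complex) \<Rightarrow> bool" where
  "holo_on X W f \<longleftrightarrow>
     (\<forall>c\<in>surf_atlas X. (f \<circ> chart_inv c) holomorphic_on snd c ` (W \<inter> fst c))"

definition holo_vec_on :: "'a surface \<Rightarrow> 'a set \<Rightarrow> ('a \<Rightarrow> complex ^ 'r) \<Rightarrow> bool" where
  "holo_vec_on X W f \<longleftrightarrow> (\<forall>r. holo_on X W (\<lambda>p. f p $ r))"

definition holo_mat_on :: "'a surface \<Rightarrow> 'a set \<Rightarrow> ('a \<Rightarrow> complex ^ 'r ^ 's) \<Rightarrow> bool" where
  "holo_mat_on X W f \<longleftrightarrow> (\<forall>s. holo_vec_on X W (\<lambda>p. f p $ s))"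


section \<open>Holomorphic bundles given by transition functions\<close>

text \<open>A bundle consists of an open cover \<open>patch i\<close> (\<open>i \<in> idx\<close>) and transition functions. The
  components of a vector in the frames over \<open>patch i\<close> and \<open>patch j\<close> are related by
  \<open>v i = transition i j p * v j\<close>. Each bundle carries its own cover and its own index type.\<close>

record ('i, 'a, 'm) bundle_data =
  idx :: "'i set"
  patch :: "'i \<Rightarrow> 'a set"
  transition :: "'i \<Rightarrow> 'i \<Rightarrow> 'a \<Rightarrow> 'm"

type_synonym ('i, 'a) line = "('i, 'a, complex) bundle_data"

definition open_cover :: "'a surface \<Rightarrow> ('i, 'a, 'm) bundle_data \<Rightarrow> bool" where
  "open_cover X E \<longleftrightarrow>
     (\<forall>i\<in>idx E. openin (surf_top X) (patch E i)) \<and> (\<Union>i\<in>idx E. patch E i) = points X"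

definition line_bundle :: "'a surface \<Rightarrow> ('i, 'a) line \<Rightarrow> bool" where
  "line_bundle X E \<longleftrightarrow>
     open_cover X E \<and>
     (\<forall>i\<in>idx E. \<forall>j\<in>idx E. holo_on X (patch E i \<inter> patch E j) (transition E i j)) \<and>
     (\<forall>i\<in>idx E. \<forall>p\<in>patch E i. transition E i i p = 1) \<and>
     (\<forall>i\<in>idx E. \<forall>j\<in>idx E. \<forall>k\<in>idx E. \<forall>p\<in>patch E i \<inter> patch E j \<inter> patch E k.
        transition E i j p * transition E j k p = transition E i k p)"

definition vector_bundle :: "'a surface \<Rightarrow> ('i, 'a, complex ^ 'r ^ 'r) bundle_data \<Rightarrow> bool" where
  "vector_bundle X E \<longleftrightarrow>
     open_cover X E \<and>
     (\<forall>i\<in>idx E. \<forall>j\<in>idx E. holo_mat_on X (patch E i \<inter> patch E j) (transition E i j)) \<and>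
     (\<forall>i\<in>idx E. \<forall>p\<in>patch E i. transition E i i p = mat 1) \<and>
     (\<forall>i\<in>idx E. \<forall>j\<in>idx E. \<forall>k\<in>idx E. \<forall>p\<in>patch E i \<inter> patch E j \<inter> patch E k.
        transition E i j p ** transition E j k p = transition E i k p)"

definition trivial_line :: "'a surface \<Rightarrow> (unit, 'a) line" where
  "trivial_line X = \<lparr>idx = UNIV, patch = (\<lambda>_. points X), transition = (\<lambda>_ _ _. 1)\<rparr>"

definition line_dual :: "('i, 'a) line \<Rightarrow> ('i, 'a) line" where
  "line_dual E = \<lparr>idx = idx E, patch = patch E, transition = (\<lambda>i j p. inverse (transition E i j p))\<rparr>"

definition line_tensor :: "('i, 'a) line \<Rightarrow> ('j, 'a) line \<Rightarrow> ('i \<times> 'j, 'a) line" where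
  "line_tensor E F =
     \<lparr>idx = idx E \<times> idx F,
      patch = (\<lambda>(i, j). patch E i \<inter> patch F j),
      transition = (\<lambda>(i, j) (i', j') p. transition E i i' p * transition F j j' p)\<rparr>"

definition line_power :: "('i, 'a) line \<Rightarrow> nat \<Rightarrow> ('i, 'a) line" where
  "line_power E n = \<lparr>idx = idx E, patch = patch E, transition = (\<lambda>i j p. transition E i j p ^ n)\<rparr>"

definition pullback ::
    "'b surface \<Rightarrow> ('b \<Rightarrow> 'a) \<Rightarrow> ('i, 'a, 'm) bundle_data \<Rightarrow> ('i, 'b, 'm) bundle_data" where
  "pullback Y f E =
     \<lparr>idx = idx E,
      patch = (\<lambda>i. {y \<in> points Y. f y \<in> patch E i}),
      transition = (\<lambda>i j y. transition E i j (f y))\<rparr>"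

text \<open>An isomorphism \<open>E \<rightarrow> F\<close>, sending the component \<open>v i\<close> to the component \<open>h j i p * v i\<close>.\<close>

definition line_iso_by ::
    "'a surface \<Rightarrow> ('i, 'a) line \<Rightarrow> ('j, 'a) line \<Rightarrow> ('j \<Rightarrow> 'i \<Rightarrow> 'a \<Rightarrow> complex) \<Rightarrow> bool" where
  "line_iso_by X E F h \<longleftrightarrow>
     (\<forall>j\<in>idx F. \<forall>i\<in>idx E. holo_on X (patch F j \<inter> patch E i) (h j i) \<and>
        (\<forall>p\<in>patch F j \<inter> patch E i. h j i p \<noteq> 0)) \<and>
     (\<forall>j\<in>idx F. \<forall>j'\<in>idx F. \<forall>i\<in>idx E. \<forall>i'\<in>idx E.
        \<forall>p\<in>patch F j \<inter> patch F j' \<inter> patch E i \<inter> patch E i'.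
          h j i p * transition E i i' p = transition F j j' p * h j' i' p)"

definition line_iso :: "'a surface \<Rightarrow> ('i, 'a) line \<Rightarrow> ('j, 'a) line \<Rightarrow> bool" where
  "line_iso X E F \<longleftrightarrow> (\<exists>h. line_iso_by X E F h)"

text \<open>The canonical bundle in the frames \<open>dz\<close>: the relation \<open>v c dz\<^sub>c = v d dz\<^sub>d\<close> gives the transition
  function \<open>dz\<^sub>d / dz\<^sub>c\<close>.\<close>

definition canonical :: "'a surface \<Rightarrow> ('a chart, 'a) line" where
  "canonical X =
     \<lparr>idx = surf_atlas X, patch = fst,
      transition = (\<lambda>c d p. deriv (snd d \<circ> chart_inv c) (snd c p))\<rparr>"


section \<open>The total space of a line bundle\<close>

text \<open>A point of the fibre is the compatible family of its components; components in frames
  not defined at the base point are set to \<open>0\<close>, so that the family is unique.\<close>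

definition line_fibre :: "('i, 'a) line \<Rightarrow> 'a \<Rightarrow> ('i \<Rightarrow> complex) set" where
  "line_fibre E p =
     {v. (\<forall>i. \<not> (i \<in> idx E \<and> p \<in> patch E i) \<longrightarrow> v i = 0) \<and>
         (\<forall>i\<in>idx E. \<forall>j\<in>idx E. p \<in> patch E i \<inter> patch E j \<longrightarrow> v i = transition E i j p * v j)}"

definition total_space :: "'a surface \<Rightarrow> ('i, 'a) line \<Rightarrow> ('a \<times> ('i \<Rightarrow> complex)) set" where
  "total_space X E = (SIGMA p:points X. line_fibre E p)"

text \<open>Generated by the preimages of open boxes under the local trivialisations.\<close>

definition total_topology :: "'a surface \<Rightarrow> ('i, 'a) line \<Rightarrow> ('a \<times> ('i \<Rightarrow> complex)) topology" where
  "total_topology X E =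
     topology_generated_by
       {{x \<in> total_space X E. fst x \<in> G \<and> snd x i \<in> B} | i G B.
          i \<in> idx E \<and> openin (surf_top X) G \<and> G \<subseteq> patch E i \<and> open B}"


section \<open>Symplectic rank two bundles, cubics and the moment map\<close>

text \<open>The form is \<open>(u, w) \<mapsto> \<Sum>r s. Om a p $ r $ s * u r * w s\<close> in the frame \<open>a\<close>.\<close>

definition symplectic_form ::
    "'a surface \<Rightarrow> ('v, 'a, complex ^ 'r ^ 'r) bundle_data \<Rightarrow> ('v \<Rightarrow> 'a \<Rightarrow> complex ^ 'r ^ 'r) \<Rightarrow> bool" where
  "symplectic_form X V Om \<longleftrightarrow>
     (\<forall>a\<in>idx V. holo_mat_on X (patch V a) (Om a) \<and>
        (\<forall>p\<in>patch V a. transpose (Om a p) = - Om a p \<and> invertible (Om a p))) \<and>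
     (\<forall>a\<in>idx V. \<forall>b\<in>idx V. \<forall>p\<in>patch V a \<inter> patch V b.
        transpose (transition V a b p) ** Om a p ** transition V a b p = Om b p)"

text \<open>Elements of the third symmetric power are symmetric tensors.\<close>

type_synonym 'r tensor3 = "complex ^ 'r ^ 'r ^ 'r"

definition symmetric_tensor3 :: "('r::finite) tensor3 \<Rightarrow> bool" where
  "symmetric_tensor3 T \<longleftrightarrow>
     (\<forall>a b c. T $ a $ b $ c = T $ b $ a $ c \<and> T $ a $ b $ c = T $ a $ c $ b)"

definition act_tensor3 :: "complex ^ 'r ^ 'r \<Rightarrow> ('r::finite) tensor3 \<Rightarrow> 'r tensor3" where
  "act_tensor3 M T =
     (\<chi> a b c. \<Sum>a'\<in>UNIV. \<Sum>b'\<in>UNIV. \<Sum>c'\<in>UNIV.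
        M $ a $ a' * M $ b $ b' * M $ c $ c' * T $ a' $ b' $ c')"

text \<open>Holomorphic sections of \<open>S\<^sup>3 V \<otimes> N\<close>, in the frames over \<open>patch V a \<inter> patch N k\<close>.\<close>

definition cubic_section ::
    "'a surface \<Rightarrow> ('v, 'a, complex ^ 'r ^ 'r) bundle_data \<Rightarrow> ('n, 'a) line \<Rightarrow>
     ('v \<Rightarrow> 'n \<Rightarrow> 'a \<Rightarrow> ('r::finite) tensor3) \<Rightarrow> bool" where
  "cubic_section X V N psi \<longleftrightarrow>
     (\<forall>a\<in>idx V. \<forall>k\<in>idx N.
        (\<forall>r. holo_mat_on X (patch V a \<inter> patch N k) (\<lambda>p. psi a k p $ r)) \<and>
        (\<forall>p\<in>patch V a \<inter> patch N k. symmetric_tensor3 (psi a k p))) \<and>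
     (\<forall>a\<in>idx V. \<forall>b\<in>idx V. \<forall>k\<in>idx N. \<forall>l\<in>idx N.
        \<forall>p\<in>patch V a \<inter> patch V b \<inter> patch N k \<inter> patch N l.
          \<forall>x y z. psi a k p $ x $ y $ z =
            transition N k l p * act_tensor3 (transition V a b p) (psi b l p) $ x $ y $ z)"

text \<open>Contracting two pairs of indices of \<open>T \<otimes> T\<close> with the form gives the element
  \<open>moment_tensor Om T\<close> of the second symmetric power; lowering its second index with the form,
  \<open>u \<cdot> w \<mapsto> (v \<mapsto> u \<omega>(w, v) + w \<omega>(u, v))\<close>, turns it into a trace-free endomorphism.\<close>

definition moment_tensor :: "complex ^ 'r ^ 'r \<Rightarrow> ('r::finite) tensor3 \<Rightarrow> complex ^ 'r ^ 'r" where
  "moment_tensor Om T =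
     (\<chi> a b. \<Sum>c\<in>UNIV. \<Sum>d\<in>UNIV. \<Sum>e\<in>UNIV. \<Sum>f\<in>UNIV.
        Om $ c $ e * Om $ d $ f * T $ a $ c $ d * T $ b $ e $ f)"

definition moment_endo :: "complex ^ 'r ^ 'r \<Rightarrow> ('r::finite) tensor3 \<Rightarrow> complex ^ 'r ^ 'r" where
  "moment_endo Om T = moment_tensor Om T ** Om"

text \<open>The section \<open>Phi a c\<close> of \<open>End V \<otimes> K\<close>, in the frame \<open>a\<close> of \<open>V\<close> and the frame \<open>dz\<close> of the
  chart \<open>c\<close>, is \<open>\<mu>(\<psi>)\<close>. Here \<open>th\<close> is the isomorphism \<open>N\<^sup>2 \<rightarrow> K\<close>, needed since \<open>\<mu>(\<psi>)\<close> a priori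
  has coefficients in \<open>N\<^sup>2\<close>.\<close>

definition is_moment_section ::
    "'a surface \<Rightarrow> ('v, 'a, complex ^ 'r ^ 'r) bundle_data \<Rightarrow> ('v \<Rightarrow> 'a \<Rightarrow> complex ^ 'r ^ 'r) \<Rightarrow>
     ('n, 'a) line \<Rightarrow> ('a chart \<Rightarrow> 'n \<Rightarrow> 'a \<Rightarrow> complex) \<Rightarrow>
     ('v \<Rightarrow> 'n \<Rightarrow> 'a \<Rightarrow> ('r::finite) tensor3) \<Rightarrow>
     ('v \<Rightarrow> 'a chart \<Rightarrow> 'a \<Rightarrow> complex ^ 'r ^ 'r) \<Rightarrow> bool" where
  "is_moment_section X V Om N th psi Phi \<longleftrightarrow>
     (\<forall>a\<in>idx V. \<forall>c\<in>surf_atlas X. \<forall>k\<in>idx N. \<forall>p\<in>patch V a \<inter> fst c \<inter> patch N k.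
        Phi a c p = mat (th c k p) ** moment_endo (Om a p) (psi a k p))"


section \<open>The spectral curve\<close>

text \<open>Points \<open>(p, v)\<close> of the total space of \<open>K\<close> with \<open>det (v - \<Phi>(p)) = 0\<close>. The tautological
  section has component \<open>v c\<close> in the chart \<open>c\<close>.\<close>

definition spectral_points ::
    "'a surface \<Rightarrow> ('v, 'a, complex ^ 'r ^ 'r) bundle_data \<Rightarrow>
     ('v \<Rightarrow> 'a chart \<Rightarrow> 'a \<Rightarrow> complex ^ ('r::finite) ^ 'r) \<Rightarrow> ('a \<times> ('a chart \<Rightarrow> complex)) set" where
  "spectral_points X V Phi =
     {(p, v) \<in> total_space X (canonical X).
        \<forall>a\<in>idx V. \<forall>c\<in>surf_atlas X. p \<in> patch V a \<inter> fst c \<longrightarrow> det (mat (v c) - Phi a c p) = 0}"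

text \<open>The complex structure of \<open>S\<close> as a submanifold of the total space: the charts are all
  homeomorphisms onto open subsets of the plane whose inverses are holomorphic immersions
  into the total space, which has local coordinates \<open>snd c (fst x)\<close> and \<open>snd x c\<close>.\<close>

definition immersion_chart ::
    "'a surface \<Rightarrow> ('a \<times> ('a chart \<Rightarrow> complex)) chart \<Rightarrow> bool" where
  "immersion_chart X w \<longleftrightarrow>
     (\<forall>c\<in>surf_atlas X.
        let D = snd w ` {x \<in> fst w. fst x \<in> fst c};
            base = (\<lambda>t. snd c (fst (chart_inv w t)));
            vert = (\<lambda>t. snd (chart_inv w t) c)
        in base holomorphic_on D \<and> vert holomorphic_on D \<and>
           (\<forall>t\<in>D. deriv base t \<noteq> 0 \<or> deriv vert t \<noteq> 0))"

definition spectral_curve ::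
    "'a surface \<Rightarrow> ('v, 'a, complex ^ 'r ^ 'r) bundle_data \<Rightarrow>
     ('v \<Rightarrow> 'a chart \<Rightarrow> 'a \<Rightarrow> complex ^ ('r::finite) ^ 'r) \<Rightarrow>
     ('a \<times> ('a chart \<Rightarrow> complex)) surface" where
  "spectral_curve X V Phi =
     (let T = subtopology (total_topology X (canonical X)) (spectral_points X V Phi)
      in \<lparr>surf_top = T, surf_atlas = {w. topological_chart T w \<and> immersion_chart X w}\<rparr>)"

text \<open>Smoothness of the curve with its defining equation \<open>det (x - \<Phi>) = 0\<close>: the two partial
  derivatives of the equation have no common zero on it. In particular the curve is
  reduced, which smoothness of the mere point set would not imply.\<close>

definition smooth_spectral_curve ::
    "'a surface \<Rightarrow> ('v, 'a, complex ^ 'r ^ 'r) bundle_data \<Rightarrow>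
     ('v \<Rightarrow> 'a chart \<Rightarrow> 'a \<Rightarrow> complex ^ ('r::finite) ^ 'r) \<Rightarrow> bool" where
  "smooth_spectral_curve X V Phi \<longleftrightarrow>
     (\<forall>(p, v)\<in>spectral_points X V Phi. \<forall>a\<in>idx V. \<forall>c\<in>surf_atlas X. p \<in> patch V a \<inter> fst c \<longrightarrow>
        (let F = (\<lambda>z x. det (mat x - Phi a c (chart_inv c z)))
         in deriv (\<lambda>z. F z (v c)) (snd c p) \<noteq> 0 \<or> deriv (\<lambda>x. F (snd c p) x) (v c) \<noteq> 0))"

text \<open>\<open>M\<close> is the line bundle \<open>L\<^sup>*\<close> on the spectral curve: \<open>iota\<close> embeds it into \<open>\<pi>\<^sup>* V\<close> with image
  the eigenspaces of \<open>\<pi>\<^sup>* \<Phi>\<close> for the tautological eigenvalue; \<open>iota a m\<close> is the image of the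
  frame \<open>m\<close> of \<open>M\<close> in the frame \<open>a\<close> of \<open>V\<close>.\<close>

definition eigenline_bundle ::
    "'a surface \<Rightarrow> ('v, 'a, complex ^ 'r ^ 'r) bundle_data \<Rightarrow>
     ('v \<Rightarrow> 'a chart \<Rightarrow> 'a \<Rightarrow> complex ^ ('r::finite) ^ 'r) \<Rightarrow>
     ('m, 'a \<times> ('a chart \<Rightarrow> complex)) line \<Rightarrow>
     ('v \<Rightarrow> 'm \<Rightarrow> 'a \<times> ('a chart \<Rightarrow> complex) \<Rightarrow> complex ^ 'r) \<Rightarrow> bool" where
  "eigenline_bundle X V Phi M iota \<longleftrightarrow>
     (let S = spectral_curve X V Phi; W = pullback S fst V
      in line_bundle S M \<and>
         (\<forall>a\<in>idx W. \<forall>m\<in>idx M. holo_vec_on S (patch W a \<inter> patch M m) (iota a m)) \<and>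
         (\<forall>a\<in>idx W. \<forall>m\<in>idx M. \<forall>x\<in>patch W a \<inter> patch M m. iota a m x \<noteq> 0 \<and>
            (\<forall>c\<in>surf_atlas X. fst x \<in> fst c \<longrightarrow>
               {u. Phi a c (fst x) *v u = snd x c *s u} = range (\<lambda>t. t *s iota a m x))) \<and>
         (\<forall>a\<in>idx W. \<forall>b\<in>idx W. \<forall>m\<in>idx M. \<forall>n\<in>idx M.
            \<forall>x\<in>patch W a \<inter> patch W b \<inter> patch M m \<inter> patch M n.
              transition W a b x *v iota b n x = transition M m n x *s iota a m x))"

end

theory Submission
  imports Defs
begin

text \<open>
  Why \<open>U\<^sup>3\<close> is trivial: the cubic \<open>\<psi>\<close> itself produces a nowhere vanishing section of \<open>U\<^sup>-\<^sup>3\<close>.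

  At a point of the spectral curve let \<open>T\<close> be the value of \<open>\<psi>\<close>, \<open>E = \<mu>(T)\<close> the moment
  endomorphism, \<open>y\<close> the tautological eigenvalue of \<open>E\<close> and \<open>u\<close> an eigenvector, that is, a
  generator of the fibre of \<open>L\<^sup>*\<close>. A generic binary cubic is a sum \<open>T = v\<^sup>3 + w\<^sup>3\<close> of two cubes,
  where \<open>v\<close> and \<open>w\<close> span the two eigenlines of \<open>E\<close>, with eigenvalues \<open>y\<close> and \<open>- y\<close>. Applying
  \<open>y + E\<close> to one tensor slot of \<open>T\<close> therefore kills \<open>w\<^sup>3\<close> and leaves \<open>2 y v\<^sup>3\<close>, the cube of an
  element of \<open>L\<^sup>*\<close> up to a factor. The tensor \<open>R = (y + E) T\<close> (\<open>eigencubic\<close>) makes sense for every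
  cubic, and it remains a multiple of \<open>u\<^sup>3\<close> where \<open>E\<close> is nilpotent: \<open>E\<^sup>2 = y\<^sup>2\<close> by Cayley-Hamilton,
  so \<open>(E - y) (E + y) = 0\<close> puts every slice of \<open>R\<close> on the eigenline, and \<open>R\<close> is a symmetric tensor.
  The multiple is not zero even over the branch points, where \<open>v\<close> and \<open>w\<close> come together: \<open>R = 0\<close>
  would force the Hessian of \<open>T\<close>, hence \<open>E\<close>, to vanish, and then the eigenspace would not be a
  line. All of this is in \<open>eigencubic_eq_cube_of_eigenvector\<close>.

  Globally \<open>T\<close> has coefficients in \<open>K\<^sup>1\<^sup>/\<^sup>2\<close> and \<open>y\<close> in \<open>K\<close>, and the construction of \<open>R\<close> commutes with
  changes of frame (\<open>eigencubic_equivariant\<close>). So \<open>R\<close> is a nowhere vanishing section of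
  \<open>(L\<^sup>*)\<^sup>3 \<otimes> K\<^sup>3\<^sup>/\<^sup>2\<close>, and since \<open>L = U \<otimes> K\<^sup>1\<^sup>/\<^sup>2\<close> this bundle is \<open>U\<^sup>-\<^sup>3\<close>. The function by which \<open>R\<close>
  is a multiple of \<open>u\<^sup>3\<close> solves linear equations with holomorphic coefficients and no common zero,
  so it is holomorphic (\<open>holo_on_solution\<close>).
\<close>

(* Formal power series use the same infix for their coefficients as vectors. *)
no_notation fps_nth (infixl \<open>$\<close> 75)

section \<open>Binary cubics and eigenvectors of the moment endomorphism\<close>

text \<open>On a cubic \<open>v\<^sup>3 + w\<^sup>3\<close> with eigenvectors \<open>v\<close>, \<open>w\<close> of eigenvalues \<open>y\<close>, \<open>- y\<close> this is
  \<open>2 y v\<^sup>3\<close>. Up to a constant factor the term with \<open>moment_endo\<close> is the classical cubic covariant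
  of \<open>T\<close>, which is why the result is again symmetric although only the first slot is acted upon.\<close>

definition eigencubic ::
    "complex ^ 'r ^ 'r \<Rightarrow> complex \<Rightarrow> ('r::finite) tensor3 \<Rightarrow> 'r tensor3" where
  "eigencubic Om y T =
     (\<chi> a b c. y * T $ a $ b $ c + (\<Sum>d\<in>UNIV. moment_endo Om T $ a $ d * T $ d $ b $ c))"

lemma symmetric_tensor3_components:
  fixes T :: "2 tensor3"
  assumes "symmetric_tensor3 T"
  shows "T $ 1 $ 2 $ 1 = T $ 1 $ 1 $ 2" "T $ 2 $ 1 $ 1 = T $ 1 $ 1 $ 2"
    "T $ 2 $ 1 $ 2 = T $ 1 $ 2 $ 2" "T $ 2 $ 2 $ 1 = T $ 1 $ 2 $ 2"
  using assms unfolding symmetric_tensor3_def by metis+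

lemma skew_components:
  fixes Om :: "complex ^ 2 ^ 2"
  assumes "transpose Om = - Om"
  shows "Om $ 1 $ 1 = 0" "Om $ 2 $ 2 = 0" "Om $ 2 $ 1 = - Om $ 1 $ 2"
proof -
  have t: "Om $ j $ i = - Om $ i $ j" for i j
    using arg_cong[OF assms, of "\<lambda>M. M $ i $ j"] by (simp add: transpose_def)
  show "Om $ 1 $ 1 = 0" "Om $ 2 $ 2 = 0" "Om $ 2 $ 1 = - Om $ 1 $ 2"
    using t[of 1 1] t[of 2 2] t[of 2 1] by simp_all
qed

text \<open>The entries are, up to sign and scale, the coefficients of the Hessian of the binary cubic.\<close>

lemma moment_endo_components:
  fixes T :: "2 tensor3"
  assumes "transpose Om = - Om" "symmetric_tensor3 T"
  shows "moment_endo Om T $ 1 $ 1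
      = - ((Om $ 1 $ 2) ^ 3 * (T $ 1 $ 1 $ 1 * T $ 2 $ 2 $ 2 - T $ 1 $ 1 $ 2 * T $ 1 $ 2 $ 2))"
    "moment_endo Om T $ 1 $ 2
      = 2 * (Om $ 1 $ 2) ^ 3 * (T $ 1 $ 1 $ 1 * T $ 1 $ 2 $ 2 - (T $ 1 $ 1 $ 2)\<^sup>2)"
    "moment_endo Om T $ 2 $ 1
      = - 2 * (Om $ 1 $ 2) ^ 3 * (T $ 1 $ 1 $ 2 * T $ 2 $ 2 $ 2 - (T $ 1 $ 2 $ 2)\<^sup>2)"
    "moment_endo Om T $ 2 $ 2
      = (Om $ 1 $ 2) ^ 3 * (T $ 1 $ 1 $ 1 * T $ 2 $ 2 $ 2 - T $ 1 $ 1 $ 2 * T $ 1 $ 2 $ 2)"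
  by (simp_all add: moment_endo_def moment_tensor_def matrix_matrix_mult_def sum_2
      skew_components[OF assms(1)] symmetric_tensor3_components[OF assms(2)]
      power2_eq_square power3_eq_cube algebra_simps)

text \<open>Contracting with the form twice is a bilinear pairing of the slices \<open>T $ a\<close>. Written as a
  trace it is visibly invariant under simultaneous base change of slices and form, which gives
  the equivariance of the moment map without expanding polynomials of high degree.\<close>

lemma moment_tensor_trace:
  fixes T :: "2 tensor3"
  shows "moment_tensor Om T $ a $ b = trace (transpose (T $ a) ** Om ** T $ b ** transpose Om)"
  by (simp add: moment_tensor_def trace_def transpose_def matrix_matrix_mult_def sum_2 algebra_simps)

text \<open>The slices of \<open>T'\<close> are combinations, with coefficients from \<open>G\<close>, of the base changed slices
  of \<open>T\<close>; pairing them leaves one factor \<open>G\<close> on each side of the moment tensor. The scalar \<open>t\<close> is a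
  change of frame of the line bundle twisting the cubics; \<open>\<mu>\<close> is quadratic in it.\<close>

lemma moment_endo_equivariant:
  fixes T T' :: "2 tensor3"
  assumes T': "\<And>a b c. T' $ a $ b $ c = t * act_tensor3 G T $ a $ b $ c"
  shows "moment_endo Om T' ** G = mat (t\<^sup>2) ** G ** moment_endo (transpose G ** Om ** G) T"
proof -
  let ?Om = "transpose G ** Om ** G"
  define X where "X i = G ** T $ i ** transpose G" for i
  have slice: "T' $ a $ c $ d = t * (G $ a $ 1 * X 1 $ c $ d + G $ a $ 2 * X 2 $ c $ d)" for a c d
    by (simp add: T' X_def act_tensor3_def matrix_matrix_mult_def transpose_def sum_2 algebra_simps)
  have bilinear: "trace (transpose (T' $ a) ** Om ** T' $ b ** transpose Om)
      = t\<^sup>2 * (\<Sum>i\<in>UNIV. \<Sum>j\<in>UNIV. G $ a $ i * G $ b $ j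
          * trace (transpose (X i) ** Om ** X j ** transpose Om))" for a b
    by (simp add: trace_def transpose_def matrix_matrix_mult_def sum_2 slice power2_eq_square
        algebra_simps)
  have invariant: "trace (transpose (X i) ** Om ** X j ** transpose Om)
      = moment_tensor ?Om T $ i $ j" for i j
  proof -
    have "trace (transpose (X i) ** Om ** X j ** transpose Om)
        = trace (G ** (transpose (T $ i) ** ?Om ** T $ j ** transpose G ** transpose Om))"
      by (simp add: X_def matrix_transpose_mul matrix_mul_assoc)
    also have "\<dots> = trace (transpose (T $ i) ** ?Om ** T $ j ** transpose G ** transpose Om ** G)"
      by (rule trace_mul_sym)
    finally show ?thesis
      by (simp add: moment_tensor_trace matrix_transpose_mul matrix_mul_assoc)
  qed
  have "moment_tensor Om T' $ a $ b = (mat (t\<^sup>2) ** G ** moment_tensor ?Om T ** transpose G) $ a $ b"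
    for a b
    unfolding moment_tensor_trace[of Om T'] bilinear invariant
    using exhaust_2[of a]
    by (auto simp: matrix_matrix_mult_def transpose_def mat_def sum_2 algebra_simps)
  then have "moment_tensor Om T' = mat (t\<^sup>2) ** G ** moment_tensor ?Om T ** transpose G"
    by (simp add: vec_eq_iff)
  then show ?thesis
    by (simp add: moment_endo_def matrix_mul_assoc)
qed

text \<open>The eigenvalue scales as the moment endomorphism, with \<open>t\<^sup>2\<close>, and there is one more factor of
  \<open>T\<close>, so the weight is \<open>t\<^sup>3\<close>. This is what makes the powers of \<open>K\<close> cancel, as
  \<open>(L\<^sup>*)\<^sup>3 = U\<^sup>-\<^sup>3 \<otimes> K\<^sup>-\<^sup>3\<^sup>/\<^sup>2\<close>.\<close>

lemma eigencubic_equivariant: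
  fixes T T' :: "2 tensor3"
  assumes T': "\<And>a b c. T' $ a $ b $ c = t * act_tensor3 G T $ a $ b $ c"
  shows "eigencubic Om (t\<^sup>2 * y) T' $ a $ b $ c
    = t ^ 3 * act_tensor3 G (eigencubic (transpose G ** Om ** G) y T) $ a $ b $ c"
proof -
  let ?E = "moment_endo (transpose G ** Om ** G) T" and ?E' = "moment_endo Om T'"
  define z where "z = (\<lambda>d. \<Sum>b'\<in>UNIV. \<Sum>c'\<in>UNIV. G $ b $ b' * G $ c $ c' * T $ d $ b' $ c')"
  have T'z: "T' $ d $ b $ c = t * (\<Sum>d'\<in>UNIV. G $ d $ d' * z d')" for d
    by (simp add: T' act_tensor3_def z_def sum_distrib_left mult.assoc)
  have act: "act_tensor3 G (eigencubic (transpose G ** Om ** G) y T) $ a $ b $ c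
      = (\<Sum>d'\<in>UNIV. G $ a $ d' * (y * z d' + (\<Sum>d\<in>UNIV. ?E $ d' $ d * z d)))"
    by (simp add: act_tensor3_def eigencubic_def z_def sum_2 algebra_simps)
  have "(?E' ** G) $ a $ d = (mat (t\<^sup>2) ** G ** ?E) $ a $ d" for d
    using moment_endo_equivariant[OF T'] by simp
  then have E: "(\<Sum>k\<in>UNIV. ?E' $ a $ k * G $ k $ d) = t\<^sup>2 * (\<Sum>k\<in>UNIV. G $ a $ k * ?E $ k $ d)" for d
    using exhaust_2[of a] by (auto simp: matrix_matrix_mult_def mat_def sum_2 algebra_simps)
  have "(\<Sum>d\<in>UNIV. ?E' $ a $ d * (\<Sum>d'\<in>UNIV. G $ d $ d' * z d'))
      = (\<Sum>d\<in>UNIV. (\<Sum>k\<in>UNIV. ?E' $ a $ k * G $ k $ d) * z d)"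
    by (simp add: sum_2 algebra_simps)
  also have "\<dots> = t\<^sup>2 * (\<Sum>d'\<in>UNIV. G $ a $ d' * (\<Sum>d\<in>UNIV. ?E $ d' $ d * z d))"
    unfolding E by (simp add: sum_2 algebra_simps)
  finally have "t * (\<Sum>d\<in>UNIV. ?E' $ a $ d * (\<Sum>d'\<in>UNIV. G $ d $ d' * z d'))
      = t ^ 3 * (\<Sum>d'\<in>UNIV. G $ a $ d' * (\<Sum>d\<in>UNIV. ?E $ d' $ d * z d))"
    by (simp add: power2_eq_square power3_eq_cube)
  moreover have "(\<Sum>d\<in>UNIV. ?E' $ a $ d * T' $ d $ b $ c)
      = t * (\<Sum>d\<in>UNIV. ?E' $ a $ d * (\<Sum>d'\<in>UNIV. G $ d $ d' * z d'))"
    by (simp add: T'z sum_distrib_left mult_ac)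
  ultimately have "(\<Sum>d\<in>UNIV. ?E' $ a $ d * T' $ d $ b $ c)
      = t ^ 3 * (\<Sum>d'\<in>UNIV. G $ a $ d' * (\<Sum>d\<in>UNIV. ?E $ d' $ d * z d))"
    by simp
  then show ?thesis
    unfolding act by (simp add: eigencubic_def T'z sum_2 power2_eq_square power3_eq_cube algebra_simps)
qed

lemma eigencubic_symmetric:
  fixes T :: "2 tensor3"
  assumes "transpose Om = - Om" "symmetric_tensor3 T"
  shows "symmetric_tensor3 (eigencubic Om y T)"
  unfolding symmetric_tensor3_def forall_2
  by (simp add: eigencubic_def sum_2 moment_endo_components[OF assms]
      symmetric_tensor3_components[OF assms(2)] power2_eq_square algebra_simps)

text \<open>Since \<open>E\<close> has trace zero and eigenvalue \<open>y\<close>, it satisfies \<open>E\<^sup>2 = y\<^sup>2\<close>; hence \<open>(y + E) z\<close> lies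
  in the eigenspace of \<open>y\<close>, whatever \<open>z\<close> is.\<close>

lemma eigencubic_slices_in_eigenspace:
  fixes T :: "2 tensor3"
  assumes Om: "transpose Om = - Om" "symmetric_tensor3 T"
    and u: "moment_endo Om T *v u = y *s u" "u \<noteq> 0"
  shows "moment_endo Om T *v (\<chi> a. eigencubic Om y T $ a $ b $ c)
    = y *s (\<chi> a. eigencubic Om y T $ a $ b $ c)"
proof -
  let ?E = "moment_endo Om T"
  have tr: "?E $ 2 $ 2 = - ?E $ 1 $ 1"
    by (simp add: moment_endo_components[OF Om])
  have ev: "?E $ 1 $ 1 * u $ 1 + ?E $ 1 $ 2 * u $ 2 = y * u $ 1"
    "?E $ 2 $ 1 * u $ 1 - ?E $ 1 $ 1 * u $ 2 = y * u $ 2"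
    using arg_cong[OF u(1), of "\<lambda>v. v $ 1"] arg_cong[OF u(1), of "\<lambda>v. v $ 2"]
    by (simp_all add: matrix_vector_mult_def sum_2 tr)
  have "u $ 1 \<noteq> 0 \<or> u $ 2 \<noteq> 0"
    using u(2) by (simp add: vec_eq_iff forall_2)
  moreover have "(?E $ 1 $ 1 * ?E $ 1 $ 1 + ?E $ 1 $ 2 * ?E $ 2 $ 1 - y * y) * u $ 1
      = (?E $ 1 $ 1 + y) * (?E $ 1 $ 1 * u $ 1 + ?E $ 1 $ 2 * u $ 2 - y * u $ 1)
        + ?E $ 1 $ 2 * (?E $ 2 $ 1 * u $ 1 - ?E $ 1 $ 1 * u $ 2 - y * u $ 2)"
    "(?E $ 1 $ 1 * ?E $ 1 $ 1 + ?E $ 1 $ 2 * ?E $ 2 $ 1 - y * y) * u $ 2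
      = ?E $ 2 $ 1 * (?E $ 1 $ 1 * u $ 1 + ?E $ 1 $ 2 * u $ 2 - y * u $ 1)
        + (y - ?E $ 1 $ 1) * (?E $ 2 $ 1 * u $ 1 - ?E $ 1 $ 1 * u $ 2 - y * u $ 2)"
    by (simp_all add: algebra_simps)
  ultimately have cayley: "?E $ 1 $ 1 * ?E $ 1 $ 1 + ?E $ 1 $ 2 * ?E $ 2 $ 1 = y * y"
    by (auto simp: ev)
  have "p * (y * v + (p * v + q * w)) + q * (y * w + (r * v - p * w))
      = y * (y * v + (p * v + q * w)) + (p * p + q * r - y * y) * v"
    "r * (y * v + (p * v + q * w)) - p * (y * w + (r * v - p * w))
      = y * (y * w + (r * v - p * w)) + (p * p + q * r - y * y) * w"
    for p q r v w :: complex
    by (simp_all add: algebra_simps)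
  note expand = this[where p = "?E $ 1 $ 1" and q = "?E $ 1 $ 2" and r = "?E $ 2 $ 1",
      unfolded cayley, simplified]
  show ?thesis
    unfolding vec_eq_iff forall_2
    by (simp add: matrix_vector_mult_def eigencubic_def sum_2 tr expand)
qed

text \<open>Membership in \<open>u \<otimes> (any) \<otimes> (any)\<close> spreads to the other two slots by symmetry.\<close>

lemma symmetric_tensor3_slices_on_line:
  assumes sym: "symmetric_tensor3 R" and u: "(u :: complex ^ 'r::finite) \<noteq> 0"
    and line: "\<And>b c. (\<chi> a. R $ a $ b $ c) \<in> range (\<lambda>t. t *s u)"
  obtains s where "\<And>a b c. R $ a $ b $ c = s * u $ a * u $ b * u $ c"
proof -
  obtain r where r: "u $ r \<noteq> 0"
    using u by (auto simp: vec_eq_iff)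
  have "\<forall>b c. \<exists>t. \<forall>a. R $ a $ b $ c = t * u $ a"
    using line by (fastforce simp: vec_eq_iff image_iff)
  then obtain t where t: "R $ a $ b $ c = t b c * u $ a" for a b c
    by metis
  have swap: "R $ a $ b $ c = R $ b $ a $ c" "R $ a $ b $ c = R $ a $ c $ b" for a b c
    using sym unfolding symmetric_tensor3_def by blast+
  have first: "t b c * u $ r = t r c * u $ b" for b c
    using swap(1)[of r b c] by (simp add: t)
  have "t r c = t c r" for c
    using swap(2)[of r r c] r by (simp add: t)
  then have second: "t r c * u $ r = t r r * u $ c" for c
    using first[of c r] by metis
  have "t b c * u $ r * u $ r = (t r c * u $ r) * u $ b" for b c
    using arg_cong[OF first[of b c], of "\<lambda>x. x * u $ r"] by (simp add: mult_ac)
  then have "t b c * u $ r * u $ r = t r r * u $ c * u $ b" for b c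
    by (simp only: second)
  then have coeff: "t b c = t r r / (u $ r)\<^sup>2 * u $ b * u $ c" for b c
    using r by (simp add: divide_simps power2_eq_square mult_ac)
  have "R $ a $ b $ c = t r r / (u $ r)\<^sup>2 * u $ a * u $ b * u $ c" for a b c
    by (subst t, subst coeff) (simp add: mult_ac)
  then show thesis by (rule that)
qed

text \<open>Let \<open>A, B, C, D\<close> be the coefficients of \<open>T\<close>. If \<open>(y + E) T = 0\<close>, every row of \<open>y + E\<close> is a linear
  relation between \<open>(A, B, C)\<close> and \<open>(B, C, D)\<close>. The minors of these two vectors are, up to factors, the
  entries of \<open>E\<close>. So \<open>E \<noteq> 0\<close> leaves only the zero relation, and \<open>E = - y\<close>; but \<open>E\<close> has trace zero,
  so \<open>y = 0\<close> and \<open>E = 0\<close>.\<close>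

lemma eigencubic_nonzero:
  fixes T :: "2 tensor3"
  assumes Om: "transpose Om = - Om" "symmetric_tensor3 T" and E: "moment_endo Om T \<noteq> 0"
  shows "eigencubic Om y T \<noteq> 0"
proof
  assume "eigencubic Om y T = 0"
  then have z: "eigencubic Om y T $ a $ b $ c = 0" for a b c
    by simp
  let ?E = "moment_endo Om T"
  define A where "A = T $ 1 $ 1 $ 1"
  define B where "B = T $ 1 $ 1 $ 2"
  define C where "C = T $ 1 $ 2 $ 2"
  define D where "D = T $ 2 $ 2 $ 2"
  note comps = symmetric_tensor3_components[OF Om(2), folded A_def B_def C_def D_def]
    moment_endo_components[OF Om, folded A_def B_def C_def D_def]
  have catalecticant: "\<not> (A * C = B\<^sup>2 \<and> A * D = B * C \<and> B * D = C\<^sup>2)"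
    using E by (auto simp: vec_eq_iff forall_2 comps)
  have relation: "p = 0 \<and> q = 0"
    if "p * A + q * B = 0" "p * B + q * C = 0" "p * C + q * D = 0" for p q
  proof -
    have "p * (A * C - B\<^sup>2) = C * (p * A + q * B) - B * (p * B + q * C)"
      "q * (A * C - B\<^sup>2) = A * (p * B + q * C) - B * (p * A + q * B)"
      "p * (A * D - B * C) = D * (p * A + q * B) - B * (p * C + q * D)"
      "q * (A * D - B * C) = A * (p * C + q * D) - C * (p * A + q * B)"
      "p * (B * D - C\<^sup>2) = D * (p * B + q * C) - C * (p * C + q * D)"
      "q * (B * D - C\<^sup>2) = B * (p * C + q * D) - C * (p * B + q * C)"
      by (simp_all add: power2_eq_square algebra_simps)
    then show ?thesis using catalecticant by (auto simp: that)
  qed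
  have "y + ?E $ 1 $ 1 = 0 \<and> ?E $ 1 $ 2 = 0"
    using z[of 1 1 1] z[of 1 1 2] z[of 1 2 2]
    by (intro relation) (simp_all add: eigencubic_def sum_2 comps(1-4) A_def[symmetric]
        B_def[symmetric] C_def[symmetric] D_def[symmetric] algebra_simps)
  moreover have "?E $ 2 $ 1 = 0 \<and> y + ?E $ 2 $ 2 = 0"
    using z[of 2 1 1] z[of 2 1 2] z[of 2 2 2]
    by (intro relation) (simp_all add: eigencubic_def sum_2 comps(1-4) A_def[symmetric]
        B_def[symmetric] C_def[symmetric] D_def[symmetric] algebra_simps)
  moreover have "?E $ 1 $ 1 + ?E $ 2 $ 2 = 0"
    by (simp add: comps)
  ultimately have "?E = 0"
    by (simp add: vec_eq_iff forall_2 add_eq_0_iff2)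
  with E show False by simp
qed

lemma act_tensor3_cube:
  fixes G :: "complex ^ 2 ^ 2"
  assumes "\<And>a b c. R $ a $ b $ c = s * u $ a * u $ b * u $ c"
  shows "act_tensor3 G R $ a $ b $ c = s * (G *v u) $ a * (G *v u) $ b * (G *v u) $ c"
proof -
  have "act_tensor3 G R $ a $ b $ c
      = s * ((\<Sum>i\<in>UNIV. G $ a $ i * u $ i)
          * ((\<Sum>j\<in>UNIV. G $ b $ j * u $ j) * (\<Sum>k\<in>UNIV. G $ c $ k * u $ k)))"
    unfolding act_tensor3_def sum_product by (simp add: assms sum_distrib_left mult_ac)
  then show ?thesis
    by (simp add: matrix_vector_mult_def mult_ac)
qed

text \<open>The one-dimensional eigenspace enters twice: it puts the slices on the line of \<open>u\<close>, and it
  excludes \<open>E = 0\<close>, whose only eigenspace is the whole plane.\<close>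

lemma eigencubic_eq_cube_of_eigenvector:
  fixes T :: "2 tensor3"
  assumes Om: "transpose Om = - Om" "symmetric_tensor3 T" and u: "u \<noteq> 0"
    and line: "{v. moment_endo Om T *v v = y *s v} = range (\<lambda>t. t *s u)"
  obtains s where "s \<noteq> 0" "\<And>a b c. eigencubic Om y T $ a $ b $ c = s * u $ a * u $ b * u $ c"
proof -
  have "1 *s u \<in> {v. moment_endo Om T *v v = y *s v}"
    unfolding line by blast
  then have eigen: "moment_endo Om T *v u = y *s u"
    by simp
  have "(\<chi> a. eigencubic Om y T $ a $ b $ c) \<in> range (\<lambda>t. t *s u)" for b c
    using eigencubic_slices_in_eigenspace[OF Om eigen u, of b c] line by blast
  then obtain s where s: "eigencubic Om y T $ a $ b $ c = s * u $ a * u $ b * u $ c" for a b c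
    using symmetric_tensor3_slices_on_line[OF eigencubic_symmetric[OF Om] u] by metis
  have "moment_endo Om T \<noteq> 0"
  proof
    assume zero: "moment_endo Om T = 0"
    then have "y = 0"
      using eigen u by (auto simp: vec_eq_iff matrix_vector_mult_def)
    with zero line have plane: "v \<in> range (\<lambda>t. t *s u)" for v
      by (auto simp: vec_eq_iff matrix_vector_mult_def)
    obtain p q where p: "axis 1 1 = p *s u" and q: "axis 2 1 = q *s u"
      using plane[of "axis 1 1"] plane[of "axis 2 1"] by blast
    have "p * u $ 1 = 1" "p * u $ 2 = 0" "q * u $ 2 = 1"
      using arg_cong[OF p, of "\<lambda>v. v $ 1"] arg_cong[OF p, of "\<lambda>v. v $ 2"]
        arg_cong[OF q, of "\<lambda>v. v $ 2"] by (auto simp: axis_def)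
    then show False by auto
  qed
  then have "eigencubic Om y T \<noteq> 0"
    by (rule eigencubic_nonzero[OF Om])
  then have "s \<noteq> 0"
    using s by (auto simp: vec_eq_iff)
  with s show thesis by (rule that[rotated])
qed

lemma scalar_matrix_mult_vector: "(mat r ** A) *v u = r *s (A *v (u :: 'a::comm_semiring_1 ^ 'n))"
proof -
  have "mat r *v w = r *s w" for w :: "'a ^ 'm"
    by (simp add: vec_eq_iff matrix_vector_mult_def mat_def if_distrib if_distribR cong: if_cong)
  then show ?thesis
    by (simp add: matrix_vector_mul_assoc[symmetric])
qed

text \<open>Eigenvalues on matching eigenlines are compared through the eigenvectors, so that the
  transformation of the tautological eigenvalue follows from that of the moment endomorphism.\<close>

lemma eigenvalue_intertwined:
  fixes u u' :: "complex ^ 'r::finite"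
  assumes "E' ** G = mat r ** G ** E" "E *v u = y *s u" "E' *v u' = y' *s u'"
    and "G *v u = m *s u'" "m \<noteq> 0" "u' \<noteq> 0"
  shows "y' = r * y"
proof -
  have "(m * y') *s u' = m *s (E' *v u')"
    by (simp add: assms(3))
  also have "\<dots> = E' *v (G *v u)"
    by (simp add: assms(4) vec.scale)
  also have "\<dots> = r *s (G *v (E *v u))"
    by (simp add: matrix_vector_mul_assoc assms(1) scalar_matrix_mult_vector
        flip: matrix_mul_assoc)
  also have "\<dots> = (r * y * m) *s u'"
    by (simp add: assms(2,4) vec.scale)
  finally show ?thesis
    using assms(5,6) by (auto simp: vec_eq_iff)
qed

section \<open>Holomorphic functions on surfaces\<close>

lemma open_chart_image:
  assumes c: "topological_chart T c" and W: "openin T W"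
  shows "open (snd c ` (W \<inter> fst c))"
proof -
  have "open_map (subtopology T (fst c)) (top_of_set (snd c ` fst c)) (snd c)"
    using c by (simp add: topological_chart_def homeomorphic_imp_open_map)
  moreover have "openin (subtopology T (fst c)) (W \<inter> fst c)"
    using W by (simp add: openin_subtopology_Int)
  ultimately have "openin (top_of_set (snd c ` fst c)) (snd c ` (W \<inter> fst c))"
    unfolding open_map_def by blast
  with c show ?thesis
    by (auto simp: topological_chart_def intro: openin_open_trans)
qed

lemma topological_chart_inj:
  assumes "topological_chart T c"
  shows "inj_on (snd c) (fst c)"
proof -
  have "topspace (subtopology T (fst c)) = fst c"
    using assms openin_subset by (auto simp: topological_chart_def)
  moreover have "homeomorphic_map (subtopology T (fst c)) (top_of_set (snd c ` fst c)) (snd c)"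
    using assms by (simp add: topological_chart_def)
  ultimately show ?thesis
    using homeomorphic_imp_injective_map by fastforce
qed

lemma holomorphic_on_locally:
  assumes "\<And>z. z \<in> A \<Longrightarrow> \<exists>B. open B \<and> z \<in> B \<and> f holomorphic_on B"
  shows "f holomorphic_on A"
  unfolding holomorphic_on_def
proof
  fix z assume "z \<in> A"
  with assms obtain B where "open B" "z \<in> B" "f holomorphic_on B"
    by blast
  then show "f field_differentiable at z within A"
    by (metis field_differentiable_at_within holomorphic_on_imp_differentiable_at)
qed

lemma holo_on_subset: "holo_on X W f \<Longrightarrow> W' \<subseteq> W \<Longrightarrow> holo_on X W' f"
  unfolding holo_on_def by (blast intro: holomorphic_on_subset)

lemma holo_on_mult: "holo_on X W f \<Longrightarrow> holo_on X W g \<Longrightarrow> holo_on X W (\<lambda>x. f x * g x)"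
  by (auto simp: holo_on_def o_def intro!: holomorphic_intros)

lemma holo_on_add: "holo_on X W f \<Longrightarrow> holo_on X W g \<Longrightarrow> holo_on X W (\<lambda>x. f x + g x)"
  by (auto simp: holo_on_def o_def intro!: holomorphic_intros)

lemma holo_on_sum: "(\<And>i. i \<in> I \<Longrightarrow> holo_on X W (f i)) \<Longrightarrow> holo_on X W (\<lambda>x. \<Sum>i\<in>I. f i x)"
  by (auto simp: holo_on_def o_def intro!: holomorphic_intros)

lemma holo_on_power: "holo_on X W f \<Longrightarrow> holo_on X W (\<lambda>x. f x ^ n)"
  by (auto simp: holo_on_def o_def intro!: holomorphic_intros)

lemma holo_on_divide:
  assumes "\<forall>c\<in>surf_atlas X. topological_chart (surf_top X) c"
    and "holo_on X W f" "holo_on X W g" "\<And>x. x \<in> W \<Longrightarrow> g x \<noteq> 0"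
  shows "holo_on X W (\<lambda>x. f x / g x)"
  unfolding holo_on_def
proof
  fix c assume c: "c \<in> surf_atlas X"
  have "inj_on (snd c) (fst c)"
    using assms(1) c topological_chart_inj by blast
  then have "(f \<circ> chart_inv c) z / (g \<circ> chart_inv c) z = ((\<lambda>x. f x / g x) \<circ> chart_inv c) z"
    and "(g \<circ> chart_inv c) z \<noteq> 0" if "z \<in> snd c ` (W \<inter> fst c)" for z
    using that assms(4) by auto
  moreover have "(f \<circ> chart_inv c) holomorphic_on snd c ` (W \<inter> fst c)"
    "(g \<circ> chart_inv c) holomorphic_on snd c ` (W \<inter> fst c)"
    using assms(2,3) c by (auto simp: holo_on_def)
  ultimately show "((\<lambda>x. f x / g x) \<circ> chart_inv c) holomorphic_on snd c ` (W \<inter> fst c)"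
    using holomorphic_on_divide[of "f \<circ> chart_inv c" _ "g \<circ> chart_inv c"]
    by (simp add: o_def)
qed

lemma holo_on_locally:
  assumes charts: "\<forall>c\<in>surf_atlas X. topological_chart (surf_top X) c"
    and local: "\<And>x. x \<in> W \<Longrightarrow> \<exists>W'. openin (surf_top X) W' \<and> x \<in> W' \<and> holo_on X W' f"
  shows "holo_on X W f"
  unfolding holo_on_def
proof (intro ballI holomorphic_on_locally)
  fix c z assume c: "c \<in> surf_atlas X" and "z \<in> snd c ` (W \<inter> fst c)"
  then obtain x where x: "x \<in> W" "x \<in> fst c" "z = snd c x"
    by blast
  with local obtain W' where W': "openin (surf_top X) W'" "x \<in> W'" "holo_on X W' f"
    by blast
  then have "open (snd c ` (W' \<inter> fst c))"
    using charts c open_chart_image by blast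
  with W' x c show "\<exists>B. open B \<and> z \<in> B \<and> (f \<circ> chart_inv c) holomorphic_on B"
    unfolding holo_on_def by blast
qed

text \<open>Near each point one of the coefficients \<open>g r\<close> is nonzero, and there \<open>s\<close> is the quotient
  \<open>F r / g r\<close>.\<close>

lemma holo_on_solution:
  assumes charts: "\<forall>c\<in>surf_atlas X. topological_chart (surf_top X) c"
    and W: "openin (surf_top X) W"
    and holo: "\<And>r. holo_on X W (g r)" "\<And>r. holo_on X W (F r)"
    and solution: "\<And>x r. x \<in> W \<Longrightarrow> s x * g r x = F r x"
    and no_common_zero: "\<And>x. x \<in> W \<Longrightarrow> \<exists>r. g r x \<noteq> 0"
  shows "holo_on X W s"
  unfolding holo_on_def
proof (intro ballI holomorphic_on_locally)
  fix c z assume c: "c \<in> surf_atlas X" and z: "z \<in> snd c ` (W \<inter> fst c)" (is "z \<in> ?A")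
  have inj: "inj_on (snd c) (fst c)" and A: "open ?A"
    using charts c W topological_chart_inj open_chart_image by blast+
  have inv: "chart_inv c w \<in> W" if "w \<in> ?A" for w
    using that inj by auto
  obtain r where r: "g r (chart_inv c z) \<noteq> 0"
    using no_common_zero inv z by blast
  let ?B = "?A \<inter> (g r \<circ> chart_inv c) -` (- {0})"
  have g: "(g r \<circ> chart_inv c) holomorphic_on ?A" and F: "(F r \<circ> chart_inv c) holomorphic_on ?A"
    using holo c by (auto simp: holo_on_def)
  have "open ?B"
    by (intro continuous_open_preimage holomorphic_on_imp_continuous_on g A) auto
  moreover have "(\<lambda>w. (F r \<circ> chart_inv c) w / (g r \<circ> chart_inv c) w) holomorphic_on ?B"
    by (intro holomorphic_on_divide holomorphic_on_subset[OF g] holomorphic_on_subset[OF F]) auto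
  then have "(s \<circ> chart_inv c) holomorphic_on ?B"
  proof (rule holomorphic_transform)
    fix w assume "w \<in> ?B"
    then show "(F r \<circ> chart_inv c) w / (g r \<circ> chart_inv c) w = (s \<circ> chart_inv c) w"
      using solution[OF inv, of w r] by (simp add: field_simps)
  qed
  ultimately show "\<exists>B. open B \<and> z \<in> B \<and> (s \<circ> chart_inv c) holomorphic_on B"
    using z r by (intro exI[of _ ?B]) auto
qed

lemma holo_on_eigencubic:
  assumes "\<And>a b. holo_on X W (\<lambda>x. Om x $ a $ b)" "holo_on X W y"
    and "\<And>a b c. holo_on X W (\<lambda>x. T x $ a $ b $ c)"
  shows "holo_on X W (\<lambda>x. eigencubic (Om x) (y x) (T x) $ a $ b $ c)"
  unfolding eigencubic_def moment_endo_def moment_tensor_def matrix_matrix_mult_def vec_lambda_beta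
  by (intro holo_on_add holo_on_sum holo_on_mult assms)

lemma transition_nonzero:
  assumes "line_bundle X E" "i \<in> idx E" "j \<in> idx E" "p \<in> patch E i" "p \<in> patch E j"
  shows "transition E i j p \<noteq> 0"
proof -
  have "transition E i j p * transition E j i p = transition E i i p" "transition E i i p = 1"
    using assms unfolding line_bundle_def by blast+
  then show ?thesis by auto
qed

section \<open>Holomorphic functions on the spectral curve\<close>

lemma points_spectral_curve: "points (spectral_curve X V Phi) \<subseteq> spectral_points X V Phi"
  by (simp add: spectral_curve_def Let_def)

lemma fst_spectral_point: "x \<in> points (spectral_curve X V Phi) \<Longrightarrow> fst x \<in> points X"
  using points_spectral_curve[of X V Phi] by (fastforce simp: spectral_points_def total_space_def)

lemma spectral_curve_charts:
  "w \<in> surf_atlas (spectral_curve X V Phi) \<longleftrightarrow>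
    topological_chart (surf_top (spectral_curve X V Phi)) w \<and> immersion_chart X w"
  by (simp add: spectral_curve_def Let_def)

text \<open>Continuity of the projection \<open>\<pi>\<close>. The topology of the total space is generated by boxes
  over coordinate patches, so the preimage is decomposed along the atlas.\<close>

lemma openin_spectral_preimage:
  assumes "riemann_surface X" and G: "openin (surf_top X) G"
  shows "openin (surf_top (spectral_curve X V Phi))
    {x \<in> points (spectral_curve X V Phi). fst x \<in> G}"
proof -
  let ?T = "total_topology X (canonical X)" and ?S = "spectral_curve X V Phi"
  have X: "(\<Union>c\<in>surf_atlas X. fst c) = points X"
    "\<And>c. c \<in> surf_atlas X \<Longrightarrow> openin (surf_top X) (fst c)"
    using assms(1) by (auto simp: riemann_surface_def topological_chart_def)
  define box where "box c = {x \<in> total_space X (canonical X). fst x \<in> G \<inter> fst c \<and> snd x c \<in> UNIV}" for c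
  have "openin ?T (box c)" if c: "c \<in> surf_atlas X" for c
  proof -
    have "box c = {x \<in> total_space X (canonical X). fst x \<in> G \<inter> fst c \<and> snd x c \<in> UNIV}
        \<and> c \<in> idx (canonical X) \<and> openin (surf_top X) (G \<inter> fst c)
        \<and> G \<inter> fst c \<subseteq> patch (canonical X) c \<and> open (UNIV :: complex set)"
      using c X(2)[OF c] G by (auto simp: box_def canonical_def)
    then show ?thesis
      unfolding total_topology_def by (intro topology_generated_by_Basis CollectI exI)
  qed
  then have "openin ?T (\<Union>c\<in>surf_atlas X. box c)"
    by blast
  then have "openin (surf_top ?S) ((\<Union>c\<in>surf_atlas X. box c) \<inter> spectral_points X V Phi)"
    by (auto simp: spectral_curve_def Let_def openin_subtopology)
  moreover have "(\<Union>c\<in>surf_atlas X. box c) \<inter> spectral_points X V Phi = {x \<in> points ?S. fst x \<in> G}"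
  proof -
    have "(\<Union>c\<in>surf_atlas X. box c) \<inter> spectral_points X V Phi \<subseteq> points ?S"
      using calculation openin_subset by blast
    moreover have "x \<in> (\<Union>c\<in>surf_atlas X. box c)" if "x \<in> points ?S" "fst x \<in> G" for x
      using that points_spectral_curve[of X V Phi] fst_spectral_point[of x X V Phi] X(1)
      by (auto simp: box_def spectral_points_def)
    ultimately show ?thesis
      using points_spectral_curve[of X V Phi] by (auto simp: box_def)
  qed
  ultimately show ?thesis
    by simp
qed

lemma spectral_chart_domain:
  assumes w: "w \<in> surf_atlas (spectral_curve X V Phi)"
  shows "fst w \<subseteq> points (spectral_curve X V Phi)"
  using w openin_subset by (auto simp: spectral_curve_charts topological_chart_def)

lemma holo_on_tautological_section:
  assumes c: "c \<in> surf_atlas X"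
  shows "holo_on (spectral_curve X V Phi) {x \<in> points (spectral_curve X V Phi). fst x \<in> fst c}
    (\<lambda>x. snd x c)"
  unfolding holo_on_def
proof
  fix w assume w: "w \<in> surf_atlas (spectral_curve X V Phi)"
  have "{x \<in> points (spectral_curve X V Phi). fst x \<in> fst c} \<inter> fst w = {x \<in> fst w. fst x \<in> fst c}"
    using spectral_chart_domain[OF w] by auto
  then show "((\<lambda>x. snd x c) \<circ> chart_inv w) holomorphic_on
      snd w ` ({x \<in> points (spectral_curve X V Phi). fst x \<in> fst c} \<inter> fst w)"
    using w c by (auto simp: spectral_curve_charts immersion_chart_def Let_def o_def)
qed

text \<open>The projection \<open>\<pi>\<close> is holomorphic because its coordinate expression is the first component
  of an immersion chart. An immersion chart is only tested over one chart of the base at a time,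
  whence the localisation.\<close>

lemma holo_on_spectral_pullback:
  assumes X: "riemann_surface X" and W: "openin (surf_top X) W" and f: "holo_on X W f"
  shows "holo_on (spectral_curve X V Phi) {x \<in> points (spectral_curve X V Phi). fst x \<in> W}
    (\<lambda>x. f (fst x))"
proof (rule holo_on_locally)
  let ?S = "spectral_curve X V Phi"
  show "\<forall>w\<in>surf_atlas ?S. topological_chart (surf_top ?S) w"
    by (simp add: spectral_curve_charts)
  fix x assume "x \<in> {x \<in> points ?S. fst x \<in> W}"
  then have x: "x \<in> points ?S" "fst x \<in> W" "fst x \<in> points X"
    by (auto intro: fst_spectral_point)
  obtain c where c: "c \<in> surf_atlas X" "fst x \<in> fst c" "topological_chart (surf_top X) c"
    using X x(3) unfolding riemann_surface_def by blast
  let ?P = "{x \<in> points ?S. fst x \<in> W \<inter> fst c}"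
  have "openin (surf_top ?S) ?P"
    by (rule openin_spectral_preimage[OF X]) (use W c in \<open>auto simp: topological_chart_def\<close>)
  moreover have "holo_on ?S ?P (\<lambda>x. f (fst x))"
    unfolding holo_on_def
  proof
    fix w assume w: "w \<in> surf_atlas ?S"
    let ?D = "snd w ` (?P \<inter> fst w)"
    let ?base = "\<lambda>t. snd c (fst (chart_inv w t))"
    have inj: "inj_on (snd w) (fst w)" "inj_on (snd c) (fst c)"
      using w c topological_chart_inj[of "surf_top ?S" w] topological_chart_inj[of "surf_top X" c]
      by (simp_all add: spectral_curve_charts)
    have "?base holomorphic_on snd w ` {x \<in> fst w. fst x \<in> fst c}"
      using w c by (auto simp: spectral_curve_charts immersion_chart_def Let_def)
    then have "?base holomorphic_on ?D"
      by (rule holomorphic_on_subset) auto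
    moreover have "(f \<circ> chart_inv c) holomorphic_on snd c ` (W \<inter> fst c)"
      using f c by (simp add: holo_on_def)
    moreover have "?base ` ?D \<subseteq> snd c ` (W \<inter> fst c)"
      using inj by auto
    ultimately have "((f \<circ> chart_inv c) \<circ> ?base) holomorphic_on ?D"
      by (rule holomorphic_on_compose_gen)
    then show "((\<lambda>x. f (fst x)) \<circ> chart_inv w) holomorphic_on ?D"
      by (rule holomorphic_transform) (use inj in auto)
  qed
  ultimately show "\<exists>W'. openin (surf_top ?S) W' \<and> x \<in> W' \<and> holo_on ?S W' (\<lambda>x. f (fst x))"
    using x c by blast
qed

section \<open>The trivialisation of the cube\<close>

theorem proposition2:
  fixes Sig :: "'a surface" and g :: nat
    and N :: "('n, 'a) line" and th :: "'a chart \<Rightarrow> 'n \<Rightarrow> 'a \<Rightarrow> complex"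
    and V :: "('v, 'a, complex ^ 2 ^ 2) bundle_data" and Om :: "'v \<Rightarrow> 'a \<Rightarrow> complex ^ 2 ^ 2"
    and psi :: "'v \<Rightarrow> 'n \<Rightarrow> 'a \<Rightarrow> 2 tensor3"
    and Phi :: "'v \<Rightarrow> 'a chart \<Rightarrow> 'a \<Rightarrow> complex ^ 2 ^ 2"
    and S :: "('a \<times> ('a chart \<Rightarrow> complex)) surface"
    and Lstar :: "('m, 'a \<times> ('a chart \<Rightarrow> complex)) line"
    and iota :: "'v \<Rightarrow> 'm \<Rightarrow> 'a \<times> ('a chart \<Rightarrow> complex) \<Rightarrow> complex ^ 2"
    and U :: "('u, 'a \<times> ('a chart \<Rightarrow> complex)) line"
  assumes "compact_riemann_surface Sig" and "has_genus Sig g" and "2 \<le> g"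
    and "line_bundle Sig N" and "line_iso_by Sig (line_power N 2) (canonical Sig) th"
    and "vector_bundle Sig V" and "symplectic_form Sig V Om"
    and "cubic_section Sig V N psi"
    and "is_moment_section Sig V Om N th psi Phi"
    and "S = spectral_curve Sig V Phi" and "smooth_spectral_curve Sig V Phi"
    and "eigenline_bundle Sig V Phi Lstar iota"
    and "line_bundle S U"
    and "line_iso S (line_dual Lstar) (line_tensor U (pullback S fst N))"
  shows "line_iso S (line_power U 3) (trivial_line S)"
proof -
  let ?W = "pullback S fst V"
  note S_def = assms(10)
  have Sig: "riemann_surface Sig"
    using assms(1) by (simp add: compact_riemann_surface_def)
  have covers: "open_cover Sig N" "open_cover Sig V" "open_cover S U" "open_cover S Lstar"
    and U: "line_bundle S U" and L: "line_bundle S Lstar"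
    using assms(4,6,12,13) by (auto simp: line_bundle_def vector_bundle_def eigenline_bundle_def
        Let_def S_def)
  obtain hh where hh: "line_iso_by S (line_dual Lstar) (line_tensor U (pullback S fst N)) hh"
    using assms(14) by (auto simp: line_iso_def)

  \<comment> \<open>A choice \<open>a, k, c, m\<close> of frames of \<open>V\<close>, \<open>K\<^sup>1\<^sup>/\<^sup>2\<close>, \<open>K\<close> and \<open>L\<^sup>*\<close> around \<open>x\<close>.\<close>
  define framed where "framed a k c m x \<longleftrightarrow> a \<in> idx V \<and> k \<in> idx N \<and> c \<in> surf_atlas Sig \<and> m \<in> idx Lstar
      \<and> x \<in> points S \<and> fst x \<in> patch V a \<and> fst x \<in> patch N k \<and> fst x \<in> fst c \<and> x \<in> patch Lstar m"
    for a k c m x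
  \<comment> \<open>Dividing by \<open>th\<close> turns the eigenvalue of \<open>\<Phi>\<close> into that of \<open>\<mu>(\<psi>)\<close> with coefficients in \<open>N\<^sup>2\<close>.\<close>
  define R where "R a k c x
      = eigencubic (Om a (fst x)) (snd x c / th c k (fst x)) (psi a k (fst x))" for a k c x
  \<comment> \<open>\<open>s\<close> is the component, in the frame \<open>i\<close> of \<open>U\<close>, of the section of \<open>U\<^sup>-\<^sup>3\<close> given by \<open>R\<close>: in these
    frames \<open>hh\<^sup>3\<close> is the isomorphism of \<open>U\<^sup>-\<^sup>3\<close> with \<open>(L\<^sup>*)\<^sup>3 \<otimes> N\<^sup>3\<close>.\<close>
  define rel where "rel i a k c m x s \<longleftrightarrow> (\<forall>p q r. R a k c x $ p $ q $ r
      = s * hh (i, k) m x ^ 3 * iota a m x $ p * iota a m x $ q * iota a m x $ r)"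
    for i a k c m x s

  have frames: "\<exists>a k c m. framed a k c m x" if "x \<in> points S" for x
  proof -
    have "fst x \<in> points Sig"
      using that fst_spectral_point[of x Sig V Phi] by (simp add: S_def)
    then show ?thesis
      using that covers Sig unfolding framed_def open_cover_def riemann_surface_def by blast
  qed
  have th: "th c k (fst x) \<noteq> 0" if "framed a k c m x" for a k c m x
    using assms(5) that unfolding line_iso_by_def framed_def
    by (auto simp: canonical_def line_power_def)
  have hh_nonzero: "hh (i, k) m x \<noteq> 0" if "framed a k c m x" "i \<in> idx U" "x \<in> patch U i" for i a k c m x
    using hh that unfolding line_iso_by_def framed_def
    by (auto simp: line_tensor_def line_dual_def pullback_def)
  have skew: "transpose (Om a (fst x)) = - Om a (fst x)" if "framed a k c m x" for a k c m x
    using assms(7) that unfolding symplectic_form_def framed_def by blast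
  have sym: "symmetric_tensor3 (psi a k (fst x))" if "framed a k c m x" for a k c m x
    using assms(8) that unfolding cubic_section_def framed_def by blast
  have Phi: "Phi a c (fst x) = mat (th c k (fst x)) ** moment_endo (Om a (fst x)) (psi a k (fst x))"
    if "framed a k c m x" for a k c m x
    using assms(9) that unfolding is_moment_section_def framed_def by blast
  have iota_nonzero: "iota a m x \<noteq> 0" if "framed a k c m x" for a k c m x
    using assms(12) that unfolding eigenline_bundle_def framed_def Let_def S_def[symmetric]
    by (auto simp: pullback_def)
  have eigenline: "{u. moment_endo (Om a (fst x)) (psi a k (fst x)) *v u
      = (snd x c / th c k (fst x)) *s u} = range (\<lambda>t. t *s iota a m x)" if "framed a k c m x" for a k c m x
  proof -
    have "{u. Phi a c (fst x) *v u = snd x c *s u} = range (\<lambda>t. t *s iota a m x)"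
      using assms(12) that unfolding eigenline_bundle_def framed_def Let_def S_def[symmetric]
      by (auto simp: pullback_def)
    moreover have "Phi a c (fst x) *v u = snd x c *s u \<longleftrightarrow>
        moment_endo (Om a (fst x)) (psi a k (fst x)) *v u = (snd x c / th c k (fst x)) *s u" for u
      unfolding Phi[OF that] using th[OF that]
      by (simp add: scalar_matrix_mult_vector field_simps vec_eq_iff)
    ultimately show ?thesis by simp
  qed

  have rel_exists: "\<exists>s. s \<noteq> 0 \<and> rel i a k c m x s"
    if x: "framed a k c m x" "i \<in> idx U" "x \<in> patch U i" for i a k c m x
  proof -
    obtain s where "s \<noteq> 0" and s: "\<And>p q r. R a k c x $ p $ q $ r
        = s * iota a m x $ p * iota a m x $ q * iota a m x $ r"
      using eigencubic_eq_cube_of_eigenvector[OF skew[OF x(1)] sym[OF x(1)] iota_nonzero[OF x(1)]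
          eigenline[OF x(1)]] unfolding R_def by blast
    then show ?thesis
      using hh_nonzero[OF x] by (intro exI[of _ "s / hh (i, k) m x ^ 3"]) (simp add: rel_def)
  qed
  have rel_unique: "s = s'" if x: "framed a k c m x" "i \<in> idx U" "x \<in> patch U i"
    and rel: "rel i a k c m x s" "rel i a k c m x s'" for i a k c m x s s'
  proof -
    obtain p where "iota a m x $ p \<noteq> 0"
      using iota_nonzero[OF x(1)] by (auto simp: vec_eq_iff)
    moreover have "s * hh (i, k) m x ^ 3 * iota a m x $ p * iota a m x $ p * iota a m x $ p
        = s' * hh (i, k) m x ^ 3 * iota a m x $ p * iota a m x $ p * iota a m x $ p"
      using rel unfolding rel_def by metis
    ultimately show ?thesis
      using hh_nonzero[OF x] by simp
  qed

  \<comment> \<open>Only the frame of \<open>U\<close> matters: the transition functions of \<open>V\<close>, \<open>N\<close> and \<open>L\<^sup>*\<close> that come from \<open>R\<close>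
    and \<open>iota\<close> are absorbed by \<open>hh\<^sup>3\<close>.\<close>
  have rel_transport: "rel i a k c m x (s / transition U i j x ^ 3)"
    if x: "framed a k c m x" "i \<in> idx U" "x \<in> patch U i" and y: "framed b l d n x" "j \<in> idx U" "x \<in> patch U j"
      and rel: "rel j b l d n x s" for i j a b k l c d m n x s
  proof -
    let ?p = "fst x"
    let ?G = "transition V a b ?p" and ?t = "transition N k l ?p" and ?M = "transition Lstar m n x"
    have M: "?M \<noteq> 0"
      using transition_nonzero[OF L] x(1) y(1) unfolding framed_def by blast
    have psi: "psi a k ?p $ e $ f $ g = ?t * act_tensor3 ?G (psi b l ?p) $ e $ f $ g" for e f g
      using assms(8) x(1) y(1) unfolding cubic_section_def framed_def by blast
    have Om: "transpose ?G ** Om a ?p ** ?G = Om b ?p"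
      using assms(7) x(1) y(1) unfolding symplectic_form_def framed_def by blast
    have iota: "?G *v iota b n x = ?M *s iota a m x"
      using assms(12) x(1) y(1) unfolding eigenline_bundle_def framed_def Let_def S_def[symmetric]
      by (auto simp: pullback_def)
    have eigenvector: "moment_endo (Om a' ?p) (psi a' k' ?p) *v iota a' m' x
        = (snd x c' / th c' k' ?p) *s iota a' m' x" if "framed a' k' c' m' x" for a' k' c' m'
    proof -
      have "1 *s iota a' m' x \<in> range (\<lambda>t. t *s iota a' m' x)"
        by blast
      then show ?thesis
        unfolding eigenline[OF that, symmetric] by simp
    qed
    have "snd x c / th c k ?p = ?t\<^sup>2 * (snd x d / th d l ?p)"
      using eigenvalue_intertwined[OF moment_endo_equivariant[OF psi, of "Om a ?p", unfolded Om]
          eigenvector[OF y(1)] eigenvector[OF x(1)] iota M iota_nonzero[OF x(1)]] .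
    then have "R a k c x $ e $ f $ g = ?t ^ 3 * act_tensor3 ?G (R b l d x) $ e $ f $ g" for e f g
      unfolding R_def by (simp only: eigencubic_equivariant[OF psi] Om)
    moreover have "act_tensor3 ?G (R b l d x) $ e $ f $ g = s * hh (j, l) n x ^ 3
        * (?G *v iota b n x) $ e * (?G *v iota b n x) $ f * (?G *v iota b n x) $ g" for e f g
      using act_tensor3_cube rel unfolding rel_def by blast
    ultimately have "R a k c x $ e $ f $ g = s * (?t * ?M * hh (j, l) n x) ^ 3
        * iota a m x $ e * iota a m x $ f * iota a m x $ g" for e f g
      by (simp add: iota power_mult_distrib power3_eq_cube mult_ac)
    moreover have "hh (i, k) m x = transition U i j x * (?t * ?M * hh (j, l) n x)"
    proof -
      have "hh (i, k) m x * inverse ?M = transition U i j x * ?t * hh (j, l) n x"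
        using hh x y unfolding line_iso_by_def framed_def
        by (auto simp: line_tensor_def line_dual_def pullback_def)
      with M show ?thesis
        by (simp add: field_simps)
    qed
    moreover have "transition U i j x \<noteq> 0"
      using transition_nonzero[OF U] x y by blast
    ultimately show ?thesis
      by (simp add: rel_def power_mult_distrib)
  qed

  \<comment> \<open>Well defined, since by \<open>rel_transport\<close> with \<open>j = i\<close> all choices of frames give the same component.\<close>
  define triv where "triv i x = (THE s. \<forall>a k c m. framed a k c m x \<longrightarrow> rel i a k c m x s)" for i x
  have triv: "rel i a k c m x (triv i x)"
    if x: "framed a k c m x" "i \<in> idx U" "x \<in> patch U i" for i a k c m x
  proof -
    obtain s where s: "rel i a k c m x s"
      using rel_exists[OF x] by blast
    have "transition U i i x = 1"
      using U x(2,3) unfolding line_bundle_def by blast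
    then have "\<forall>a k c m. framed a k c m x \<longrightarrow> rel i a k c m x s"
      using rel_transport[OF _ x(2,3) x s] by fastforce
    then have "\<forall>a k c m. framed a k c m x \<longrightarrow> rel i a k c m x (triv i x)"
      unfolding triv_def by (rule theI) (use rel_unique[OF x _ s] x in blast)
    then show ?thesis
      using x by blast
  qed
  have in_S: "x \<in> points S" if "i \<in> idx U" "x \<in> patch U i" for i x
    using covers(3) that unfolding open_cover_def by blast

  have triv_nonzero: "triv i x \<noteq> 0" if i: "i \<in> idx U" "x \<in> patch U i" for i x
  proof -
    obtain a k c m where x: "framed a k c m x"
      using frames in_S[OF i] by blast
    then show ?thesis
      using rel_exists[OF x i] rel_unique[OF x i _ triv[OF x i]] by metis
  qed

  have triv_cocycle: "triv i x * transition U i j x ^ 3 = triv j x"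
    if i: "i \<in> idx U" "x \<in> patch U i" and j: "j \<in> idx U" "x \<in> patch U j" for i j x
  proof -
    obtain a k c m where x: "framed a k c m x"
      using frames in_S[OF i] by blast
    have "triv i x = triv j x / transition U i j x ^ 3"
      using rel_unique[OF x i triv[OF x i] rel_transport[OF x i x j triv[OF x j]]] .
    then show ?thesis
      using transition_nonzero[OF U] i j by simp
  qed

  have charts: "\<forall>w\<in>surf_atlas S. topological_chart (surf_top S) w"
    by (simp add: S_def spectral_curve_charts)
  have preimage_open: "openin (surf_top S) {x \<in> points S. fst x \<in> G}" if "openin (surf_top Sig) G" for G
    unfolding S_def by (rule openin_spectral_preimage[OF Sig that])
  have pullback_holo: "holo_on S {x \<in> points S. fst x \<in> G} (\<lambda>x. f (fst x))"
    if "openin (surf_top Sig) G" "holo_on Sig G f" for G f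
    unfolding S_def by (rule holo_on_spectral_pullback[OF Sig that])

  have triv_holo: "holo_on S (patch U i) (triv i)" if i: "i \<in> idx U" for i
  proof (rule holo_on_locally[OF charts])
    fix x assume "x \<in> patch U i"
    then obtain a k c m where x: "framed a k c m x"
      using frames in_S[OF i] by blast
    then have idx: "a \<in> idx V" "k \<in> idx N" "c \<in> surf_atlas Sig" "m \<in> idx Lstar"
      by (auto simp: framed_def)
    let ?D = "patch U i \<inter> Collect (framed a k c m)"
    have opens: "openin (surf_top Sig) (patch V a)" "openin (surf_top Sig) (patch N k)"
      "openin (surf_top Sig) (fst c)" "openin (surf_top S) (patch U i)"
      "openin (surf_top S) (patch Lstar m)"
      using covers idx i Sig
      by (auto simp: open_cover_def riemann_surface_def topological_chart_def)
    have D_eq: "?D = patch U i \<inter> patch Lstar m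
        \<inter> {x \<in> points S. fst x \<in> patch V a \<inter> patch N k \<inter> fst c}"
      using idx by (auto simp: framed_def)
    have D: "openin (surf_top S) ?D"
      unfolding D_eq by (intro openin_Int preimage_open opens)
    have pull: "holo_on S ?D (\<lambda>x. f (fst x))"
      if "openin (surf_top Sig) G" "holo_on Sig G f" "patch V a \<inter> patch N k \<inter> fst c \<subseteq> G" for G f
      by (rule holo_on_subset[OF pullback_holo[OF that(1,2)]]) (use that(3) in \<open>auto simp: framed_def\<close>)
    have Om_holo: "holo_on S ?D (\<lambda>x. Om a (fst x) $ p $ q)" for p q
      using assms(7) idx opens
      by (intro pull[of "patch V a"]) (auto simp: symplectic_form_def holo_mat_on_def holo_vec_on_def)
    have psi_holo: "holo_on S ?D (\<lambda>x. psi a k (fst x) $ p $ q $ r)" for p q r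
      using assms(8) idx opens
      by (intro pull[of "patch V a \<inter> patch N k"])
        (auto simp: cubic_section_def holo_mat_on_def holo_vec_on_def)
    have th_holo: "holo_on S ?D (\<lambda>x. th c k (fst x))"
      using assms(5) idx opens
      by (intro pull[of "fst c \<inter> patch N k"])
        (auto simp: line_iso_by_def canonical_def line_power_def)
    have "holo_on S ?D (\<lambda>x. snd x c)"
      unfolding S_def by (rule holo_on_subset[OF holo_on_tautological_section[OF idx(3)]])
        (auto simp: framed_def S_def)
    then have "holo_on S ?D (\<lambda>x. snd x c / th c k (fst x))"
      by (rule holo_on_divide[OF charts _ th_holo]) (use th in blast)
    then have R_holo: "holo_on S ?D (\<lambda>x. R a k c x $ r $ r $ r)" for r
      unfolding R_def by (intro holo_on_eigencubic Om_holo psi_holo)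
    have iota_holo: "holo_on S ?D (\<lambda>x. iota a m x $ r)" for r
    proof (rule holo_on_subset)
      show "holo_on S (patch ?W a \<inter> patch Lstar m) (\<lambda>x. iota a m x $ r)"
        using assms(12) idx unfolding eigenline_bundle_def Let_def S_def[symmetric]
        by (auto simp: pullback_def holo_vec_on_def)
    qed (auto simp: framed_def pullback_def)
    have hh_holo: "holo_on S ?D (hh (i, k) m)"
    proof (rule holo_on_subset)
      show "holo_on S (patch (line_tensor U (pullback S fst N)) (i, k) \<inter> patch (line_dual Lstar) m)
          (hh (i, k) m)"
        using hh idx i unfolding line_iso_by_def
        by (auto simp: line_tensor_def line_dual_def pullback_def)
    qed (auto simp: framed_def line_tensor_def line_dual_def pullback_def)
    have "holo_on S ?D (triv i)"
    proof (rule holo_on_solution[OF charts D])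
      show "holo_on S ?D (\<lambda>x. hh (i, k) m x ^ 3 * iota a m x $ r ^ 3)" for r
        by (intro holo_on_mult holo_on_power hh_holo iota_holo)
      show "triv i x * (hh (i, k) m x ^ 3 * iota a m x $ r ^ 3) = R a k c x $ r $ r $ r"
        if "x \<in> ?D" for x r
        using triv[of a k c m x i] that i by (simp add: rel_def power3_eq_cube mult_ac)
      show "\<exists>r. hh (i, k) m x ^ 3 * iota a m x $ r ^ 3 \<noteq> 0" if "x \<in> ?D" for x
        using hh_nonzero[of a k c m x i] iota_nonzero[of a k c m x] that i by (auto simp: vec_eq_iff)
    qed (rule R_holo)
    with D x \<open>x \<in> patch U i\<close>
    show "\<exists>D. openin (surf_top S) D \<and> x \<in> D \<and> holo_on S D (triv i)"
      by blast
  qed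

  have "line_iso_by S (line_power U 3) (trivial_line S) (\<lambda>_. triv)"
    unfolding line_iso_by_def
    using triv_holo triv_nonzero triv_cocycle
    by (auto simp: line_power_def trivial_line_def intro: holo_on_subset)
  then show ?thesis
    unfolding line_iso_def by blast
qed

end
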